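(* Let $\mathbb{B}_0=(X_1,X_2,X_3)$ be the basis of the Lie algebra $\mathfrak{sol}$ of $\mathrm{Sol}$ with $[X_1,X_2]=X_2$, $[X_1,X_3]=-X_3$, $[X_2,X_3]=0$. Let $b>0$ and consider the left invariant metric on $\mathrm{Sol}$ with matrix in $\mathbb{B}_0$ $$\begin{pmatrix}0&0&-\frac2b\\0&1&1\\-\frac2b&1&1\end{pmatrix}.$$ Its Ricci curvature and scalar curvature are $$M(\mathrm{ric},\mathbb{B}_0)=\begin{pmatrix} -2 & b & 0 \\ b & -\frac12b^2 & -\frac12b^2 \\ 0 & -\frac12b^2 & -\frac12b^2 \end{pmatrix},\qquad\mathfrak{s}=\frac12b^2.$$ The Ricci operator is of type $\{ab2\}$. Moreover $\det M(\mathrm{ric},\mathbb{B}_0)=\frac{b^4}2$, $\mathrm{tr}\,M(\mathrm{ric},\mathbb{B}_0)=-2-b^2$, and the signature of $\mathrm{ric}$ is $(+,-,-)$.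
   Context: $\mathrm{Sol}$ is the simply connected Lie group with Lie algebra $\mathfrak{sol}$. A left invariant metric on a Lie group with Lie algebra $\mathfrak{g}$ is identified with a nondegenerate symmetric bilinear form $\langle\,,\rangle$ on $\mathfrak{g}$. The Levi-Civita product $\mathrm{L}:\mathfrak{g}\times\mathfrak{g}\to\mathfrak{g}$ is given by $2\langle\mathrm{L}_uv,w\rangle=\langle[u,v],w\rangle+\langle[w,u],v\rangle+\langle[w,v],u\rangle$, the curvature by $\mathrm{K}(u,v)=\mathrm{L}_{[u,v]}-[\mathrm{L}_u,\mathrm{L}_v]$, the Ricci tensor by $\mathrm{ric}(u,v)=\mathrm{tr}(w\mapsto\mathrm{K}(u,w)v)$, the Ricci operator by $\langle\mathrm{Ric}(u),v\rangle=\mathrm{ric}(u,v)$, and the scalar curvature by $\mathfrak{s}=\mathrm{tr}(\mathrm{Ric})$. $M(\mathrm{ric},\mathbb{B}_0)$ is the Gram matrix of $\mathrm{ric}$ in $\mathbb{B}_0$. The signature of $\mathrm{ric}$ is its signature as a symmetric bilinear form (signs listed in any order). A symmetric endomorphism of a three dimensional Lorentzian vector space is of type $\{ab2\}$ if its Jordan form consists of a $1\times1$ block with real eigenvalue and a $2\times2$ Jordan block with real eigenvalue (the letters $a,b$ in the name of the type are generic and not the parameter of the metric). *)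

theory Defs
  imports "HOL-Analysis.Analysis"
begin

text \<open>
  An n-dimensional real Lie algebra is modelled on the coordinate space \<^typ>\<open>real ^ 'n\<close> with an
  arbitrary Lie bracket; bases are arbitrary too, so the standard basis and the standard inner
  product of \<^typ>\<open>real ^ 'n\<close> play no role. The trace of an endomorphism is the trace of its
  standard matrix.
\<close>

definition lie_bracket :: "(real ^ 'n \<Rightarrow> real ^ 'n \<Rightarrow> real ^ 'n) \<Rightarrow> bool" where
  "lie_bracket br \<longleftrightarrow> bilinear br \<and> (\<forall>u. br u u = 0) \<and>
     (\<forall>u v w. br u (br v w) + br v (br w u) + br w (br u v) = 0)"

definition is_basis :: "('n \<Rightarrow> real ^ 'n) \<Rightarrow> bool" where
  "is_basis X \<longleftrightarrow> inj X \<and> independent (range X) \<and> span (range X) = UNIV"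

definition symmetric_form :: "(real ^ 'n \<Rightarrow> real ^ 'n \<Rightarrow> real) \<Rightarrow> bool" where
  "symmetric_form h \<longleftrightarrow> bilinear h \<and> (\<forall>u v. h u v = h v u)"

definition gram_matrix :: "(real ^ 'n \<Rightarrow> real ^ 'n \<Rightarrow> real) \<Rightarrow> ('n \<Rightarrow> real ^ 'n) \<Rightarrow> real ^ 'n ^ 'n" where
  "gram_matrix h X = (\<chi> i j. h (X i) (X j))"

text \<open>
  \<open>has_signature h p q\<close>: some \<open>h\<close>-orthogonal basis contains exactly \<open>p\<close> vectors of positive
  and \<open>q\<close> of negative square; the remaining ones span the radical.
\<close>

definition has_signature :: "(real ^ 'n \<Rightarrow> real ^ 'n \<Rightarrow> real) \<Rightarrow> nat \<Rightarrow> nat \<Rightarrow> bool" where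
  "has_signature h p q \<longleftrightarrow> symmetric_form h \<and>
     (\<exists>E. is_basis E \<and> (\<forall>i j. i \<noteq> j \<longrightarrow> h (E i) (E j) = 0) \<and>
       card {i. h (E i) (E i) > 0} = p \<and> card {i. h (E i) (E i) < 0} = q)"

definition pseudo_metric :: "(real ^ 'n \<Rightarrow> real ^ 'n \<Rightarrow> real) \<Rightarrow> bool" where
  "pseudo_metric g \<longleftrightarrow> symmetric_form g \<and> (\<forall>u. (\<forall>v. g u v = 0) \<longrightarrow> u = 0)"

text \<open>
  For a \<open>pseudo_metric\<close> \<open>g\<close>, nondegeneracy makes the definite descriptions in \<open>levi_civita\<close>
  and \<open>ricci_operator\<close> well defined.
\<close>

definition levi_civita ::
  "(real ^ 'n \<Rightarrow> real ^ 'n \<Rightarrow> real ^ 'n) \<Rightarrow> (real ^ 'n \<Rightarrow> real ^ 'n \<Rightarrow> real)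
    \<Rightarrow> real ^ 'n \<Rightarrow> real ^ 'n \<Rightarrow> real ^ 'n" where
  "levi_civita br g u v =
     (THE z. \<forall>w. 2 * g z w = g (br u v) w + g (br w u) v + g (br w v) u)"

text \<open>The sign convention is \<open>K(u,v) = L\<^bsub>[u,v]\<^esub> - [L\<^bsub>u\<^esub>, L\<^bsub>v\<^esub>]\<close>.\<close>

definition curvature ::
  "(real ^ 'n \<Rightarrow> real ^ 'n \<Rightarrow> real ^ 'n) \<Rightarrow> (real ^ 'n \<Rightarrow> real ^ 'n \<Rightarrow> real)
    \<Rightarrow> real ^ 'n \<Rightarrow> real ^ 'n \<Rightarrow> real ^ 'n \<Rightarrow> real ^ 'n" where
  "curvature br g u v w =
     levi_civita br g (br u v) w
       - (levi_civita br g u (levi_civita br g v w) - levi_civita br g v (levi_civita br g u w))"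

definition ricci ::
  "(real ^ 'n \<Rightarrow> real ^ 'n \<Rightarrow> real ^ 'n) \<Rightarrow> (real ^ 'n \<Rightarrow> real ^ 'n \<Rightarrow> real)
    \<Rightarrow> real ^ 'n \<Rightarrow> real ^ 'n \<Rightarrow> real" where
  "ricci br g u v = trace (matrix (\<lambda>w. curvature br g u w v))"

definition ricci_operator ::
  "(real ^ 'n \<Rightarrow> real ^ 'n \<Rightarrow> real ^ 'n) \<Rightarrow> (real ^ 'n \<Rightarrow> real ^ 'n \<Rightarrow> real)
    \<Rightarrow> real ^ 'n \<Rightarrow> real ^ 'n" where
  "ricci_operator br g u = (THE z. \<forall>v. g z v = ricci br g u v)"

definition scalar_curvature ::
  "(real ^ 'n \<Rightarrow> real ^ 'n \<Rightarrow> real ^ 'n) \<Rightarrow> (real ^ 'n \<Rightarrow> real ^ 'n \<Rightarrow> real) \<Rightarrow> real" where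
  "scalar_curvature br g = trace (matrix (ricci_operator br g))"

text \<open>
  Type \<open>{ab2}\<close>: a symmetric endomorphism of a three dimensional Lorentzian vector space
  (signature \<open>(+,+,-)\<close>) whose Jordan form has a block of size 1 and a block of size 2, both with
  real eigenvalue. The two eigenvalues are not required to be distinct.
\<close>

definition type_ab2 :: "(real ^ 3 \<Rightarrow> real ^ 3 \<Rightarrow> real) \<Rightarrow> (real ^ 3 \<Rightarrow> real ^ 3) \<Rightarrow> bool" where
  "type_ab2 g f \<longleftrightarrow>
     has_signature g 2 1 \<and> linear f \<and> (\<forall>u v. g (f u) v = g u (f v)) \<and>
     (\<exists>(P :: real ^ 3 ^ 3) \<alpha> \<beta>. invertible P \<and>
        matrix_inv P ** matrix f ** P =
          vector [vector [\<alpha>, 0, 0],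
                  vector [0, \<beta>, 1],
                  vector [0, 0, \<beta>]])"

end

theory Submission
  imports Defs
begin

section \<open>Bases and coordinates\<close>

text \<open>Everything reduces to finite tables in the basis X. Nondegeneracy identifies vectors
  with linear functionals (\<open>pseudo_metric_represent\<close>), so the definite descriptions of
  the Levi-Civita product and the Ricci operator denote vectors satisfying their defining identities
  (\<open>koszul\<close>, \<open>metric_ricci_operator\<close>); conversely, a candidate value need
  only be paired with the basis vectors (\<open>levi_civita_eqI\<close>,
  \<open>ricci_operator_eqI\<close>). Traces may be taken in any basis
  (\<open>trace_matrix_eq_sum_coord\<close>), so the table of products gives the Gram matrix of ric,
  and this in turn gives the Ricci operator.

  On the span of X2 and X3 the Ricci operator is -b^2/2 times the swap of X2 and X3, and it sends X1
  to (b^2/2) X1 + b X3. Its eigenvalues are thus -b^2/2, on X2 + X3, and b^2/2 with multiplicity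
  two; the eigenspace of the latter is only the null line of X3 - X2, whence the 2 x 2 Jordan block.
  Signatures come from diagonalising Gram matrices by congruence
  (\<open>has_signature_gram\<close>), the Jordan form from an explicit Jordan basis
  (\<open>matrix_conjugate\<close>).\<close>

definition basis_matrix :: "('n \<Rightarrow> real ^ 'n) \<Rightarrow> real ^ 'n ^ 'n" where
  "basis_matrix X = (\<chi> i j. X j $ i)"

text \<open>These functionals form the dual basis when X is a basis. The inverse matrix makes their
  linearity immediate.\<close>

definition coord :: "('n \<Rightarrow> real ^ 'n) \<Rightarrow> 'n \<Rightarrow> real ^ 'n \<Rightarrow> real" where
  "coord X k v = (matrix_inv (basis_matrix X) *v v) $ k"

lemma basis_matrix_mult_vec: "basis_matrix X *v c = (\<Sum>i\<in>UNIV. (c $ i) *\<^sub>R X i)"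
  by (simp add: basis_matrix_def matrix_vector_mult_def vec_eq_iff mult.commute)

lemma column_basis_matrix: "column j (basis_matrix X) = X j"
  by (simp add: basis_matrix_def column_def vec_eq_iff)

lemma basis_matrix_axis: "basis_matrix X *v axis j 1 = X j"
  by (simp add: matrix_vector_mult_basis column_basis_matrix)

lemma is_basis_iff_invertible: "is_basis X \<longleftrightarrow> invertible (basis_matrix X)"
proof
  assume X: "is_basis X"
  have "columns (basis_matrix X) = range X"
    by (auto simp: columns_def column_basis_matrix)
  then have "span (columns (basis_matrix X)) = UNIV"
    using X by (simp add: is_basis_def)
  then show "invertible (basis_matrix X)"
    by (simp add: invertible_right_inverse matrix_right_invertible_span_columns
        span_vec_eq)
next
  assume inv: "invertible (basis_matrix X)"
  have cols: "columns (basis_matrix X) = range X"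
    by (auto simp: columns_def column_basis_matrix)
  have sp: "span (range X) = UNIV"
    using inv cols by (simp add: invertible_right_inverse matrix_right_invertible_span_columns
        span_vec_eq)
  have "inj ((*v) (basis_matrix X))"
    using inv by (rule inj_matrix_vector_mult)
  then have injX: "inj X"
    unfolding inj_def by (metis basis_matrix_axis axis_eq_axis zero_neq_one)
  \<comment> \<open>A spanning set with as many elements as the dimension is independent.\<close>
  have "card (range X) = dim (UNIV :: (real ^ 'a) set)"
    using injX by (simp add: card_image)
  then have "independent (range X)"
    using sp by (intro card_le_dim_spanning[of _ UNIV]) auto
  with injX sp show "is_basis X"
    by (simp add: is_basis_def)
qed

lemma matrix_inv_works:
  fixes A :: "'a::semiring_1 ^ 'n ^ 'm"
  assumes "invertible A"
  shows "matrix_inv A ** A = mat 1" and "A ** matrix_inv A = mat 1"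
  using someI_ex[OF assms[unfolded invertible_def]] by (simp_all add: matrix_inv_def)

lemma matrix_inv_basis_matrix:
  assumes "is_basis X"
  shows "matrix_inv (basis_matrix X) ** basis_matrix X = mat 1"
    and "basis_matrix X ** matrix_inv (basis_matrix X) = mat 1"
  using assms matrix_inv_works[of "basis_matrix X"] by (auto simp: is_basis_iff_invertible)

lemma coord_basis:
  assumes "is_basis X"
  shows "coord X k (X j) = (if k = j then 1 else 0)"
proof -
  have "matrix_inv (basis_matrix X) *v X j
      = matrix_inv (basis_matrix X) *v (basis_matrix X *v axis j 1)"
    by (simp add: basis_matrix_axis)
  also have "\<dots> = axis j 1"
    by (simp add: matrix_vector_mul_assoc matrix_inv_basis_matrix[OF assms])
  finally show ?thesis
    by (simp add: coord_def axis_def)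
qed

lemma linear_coord: "linear (coord X k)"
  unfolding coord_def
  by (intro linearI) (simp_all add: matrix_vector_right_distrib matrix_vector_mult_scaleR)

lemma basis_expansion:
  assumes "is_basis X"
  shows "v = (\<Sum>i\<in>UNIV. coord X i v *\<^sub>R X i)"
proof -
  have "v = basis_matrix X *v (matrix_inv (basis_matrix X) *v v)"
    by (simp add: matrix_vector_mul_assoc matrix_inv_basis_matrix[OF assms])
  then show ?thesis
    by (simp add: basis_matrix_mult_vec coord_def)
qed

lemma linear_eq_on_basis:
  assumes "is_basis X" "linear f" "linear h" "\<And>i. f (X i) = h (X i)"
  shows "f = h"
proof
  fix v
  show "f v = h v"
    using assms linear_eq_on_span[of f h "range X" v] by (auto simp: is_basis_def)
qed

text \<open>With B the basis matrix and F the standard matrix of f, the matrix of f in X is B^-1 F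
  B, and the trace is invariant under swapping the factors B^-1 and F B.\<close>

lemma trace_matrix_eq_sum_coord:
  assumes X: "is_basis X" and "linear f"
  shows "trace (matrix f) = (\<Sum>k\<in>UNIV. coord X k (f (X k)))"
proof -
  let ?B = "basis_matrix X"
  have "coord X k (f (X k)) = (matrix_inv ?B ** (matrix f ** ?B)) $ k $ k" for k
  proof -
    have "f (X k) = matrix f *v (?B *v axis k 1)"
      using \<open>linear f\<close> by (simp add: basis_matrix_axis matrix_works)
    then have "matrix_inv ?B *v f (X k) = (matrix_inv ?B ** (matrix f ** ?B)) *v axis k 1"
      by (simp add: matrix_vector_mul_assoc matrix_mul_assoc)
    then show ?thesis
      by (simp add: coord_def matrix_vector_mult_basis column_def)
  qed
  then have "(\<Sum>k\<in>UNIV. coord X k (f (X k))) = trace (matrix_inv ?B ** (matrix f ** ?B))"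
    by (simp add: trace_def)
  also have "\<dots> = trace ((matrix f ** ?B) ** matrix_inv ?B)"
    by (rule trace_mul_sym)
  also have "\<dots> = trace (matrix f)"
    by (simp flip: matrix_mul_assoc add: matrix_inv_basis_matrix[OF X])
  finally show ?thesis ..
qed

lemma basis_matrix_change:
  "basis_matrix (\<lambda>j. \<Sum>i\<in>UNIV. C $ i $ j *\<^sub>R X i) = basis_matrix X ** C"
  by (simp add: basis_matrix_def matrix_matrix_mult_def vec_eq_iff mult.commute)

lemma is_basis_change:
  assumes "is_basis X" "det C \<noteq> 0"
  shows "is_basis (\<lambda>j. \<Sum>i\<in>UNIV. C $ i $ j *\<^sub>R X i)"
  using assms
  by (simp add: is_basis_iff_invertible basis_matrix_change invertible_det_nz det_mul)

text \<open>The witness is P = B C, with B the basis matrix: M is the matrix of f in X, and C holds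
  a Jordan basis in X-coordinates when J is a Jordan form. Stating the relation as
  \<open>M ** C = C ** J\<close> avoids computing an inverse of C.\<close>

lemma matrix_conjugate:
  fixes C :: "real ^ 'n ^ 'n"
  assumes X: "is_basis X" and "linear f" and fX: "\<And>j. f (X j) = (\<Sum>i\<in>UNIV. M $ i $ j *\<^sub>R X i)"
    and C: "det C \<noteq> 0" and MC: "M ** C = C ** J"
  shows "\<exists>P. invertible P \<and> matrix_inv P ** matrix f ** P = J"
proof (intro exI conjI)
  let ?B = "basis_matrix X"
  have "matrix f ** ?B = ?B ** M"
  proof -
    have "(matrix f ** ?B) *v axis j 1 = (?B ** M) *v axis j 1" for j
    proof -
      have "(matrix f ** ?B) *v axis j 1 = f (X j)"
        using \<open>linear f\<close> by (simp flip: matrix_vector_mul_assoc add: basis_matrix_axis matrix_works)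
      also have "\<dots> = ?B *v (M *v axis j 1)"
        by (simp add: fX basis_matrix_mult_vec matrix_vector_mult_basis column_def)
      finally show ?thesis
        by (simp add: matrix_vector_mul_assoc)
    qed
    then show ?thesis
      by (simp add: matrix_vector_mult_basis column_def vec_eq_iff)
  qed
  then have eq: "matrix f ** (?B ** C) = (?B ** C) ** J"
    by (metis MC matrix_mul_assoc)
  show inv: "invertible (?B ** C)"
    using X C by (simp add: is_basis_iff_invertible invertible_det_nz det_mul)
  have "matrix_inv (?B ** C) ** matrix f ** (?B ** C) = matrix_inv (?B ** C) ** ((?B ** C) ** J)"
    by (simp flip: eq add: matrix_mul_assoc)
  also have "\<dots> = J"
    using matrix_inv_works[OF inv] by (metis matrix_mul_assoc matrix_mul_lid)
  finally show "matrix_inv (?B ** C) ** matrix f ** (?B ** C) = J" .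
qed

section \<open>Bilinear forms\<close>

lemma bilinear_linear:
  assumes "bilinear h"
  shows "linear (h u)" "linear (\<lambda>u. h u v)"
  using assms by (simp_all add: bilinear_def)

lemma bilinear_eq_on_basis:
  assumes X: "is_basis X" and "bilinear h" "bilinear k" "\<And>i j. h (X i) (X j) = k (X i) (X j)"
  shows "h = k"
proof -
  have "h (X i) = k (X i)" for i
    using assms by (intro linear_eq_on_basis[OF X]) (auto simp: bilinear_def)
  then have "(\<lambda>u. h u v) = (\<lambda>u. k u v)" for v
    using assms by (intro linear_eq_on_basis[OF X]) (auto simp: bilinear_def)
  then show ?thesis
    by (auto simp: fun_eq_iff)
qed

text \<open>A bilinear form and its flip coincide once they agree on a basis.\<close>

lemma symmetric_form_iff_gram:
  assumes X: "is_basis X" and h: "bilinear h"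
  shows "symmetric_form h \<longleftrightarrow> transpose (gram_matrix h X) = gram_matrix h X"
proof
  assume "transpose (gram_matrix h X) = gram_matrix h X"
  then have "h (X i) (X j) = h (X j) (X i)" for i j
    by (simp add: gram_matrix_def transpose_def vec_eq_iff)
  moreover have "bilinear (\<lambda>u v. h v u)"
    using h by (simp add: bilinear_def)
  ultimately have "h = (\<lambda>u v. h v u)"
    by (intro bilinear_eq_on_basis[OF X h])
  then show "symmetric_form h"
    using h unfolding symmetric_form_def by metis
qed (simp add: symmetric_form_def gram_matrix_def transpose_def vec_eq_iff)

lemma gram_matrix_change:
  assumes h: "bilinear h"
  shows "gram_matrix h (\<lambda>j. \<Sum>i\<in>UNIV. C $ i $ j *\<^sub>R X i) = transpose C ** gram_matrix h X ** C"
proof -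
  have "h (\<Sum>k\<in>UNIV. C $ k $ i *\<^sub>R X k) (\<Sum>l\<in>UNIV. C $ l $ j *\<^sub>R X l)
      = (\<Sum>l\<in>UNIV. (\<Sum>k\<in>UNIV. C $ k $ i * h (X k) (X l)) * C $ l $ j)" for i j
    by (simp add: linear_sum[OF bilinear_linear(1)[OF h]] linear_sum[OF bilinear_linear(2)[OF h]]
        bilinear_lmul[OF h] bilinear_rmul[OF h] sum_distrib_left mult.commute)
  then show ?thesis
    by (simp add: gram_matrix_def transpose_def matrix_matrix_mult_def vec_eq_iff)
qed

text \<open>Coordinates of a vector in the radical lie in the kernel of the Gram matrix, which is
  trivial.\<close>

lemma pseudo_metric_gram:
  assumes X: "is_basis X" and h: "bilinear h"
    and "transpose (gram_matrix h X) = gram_matrix h X" "det (gram_matrix h X) \<noteq> 0"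
  shows "pseudo_metric h"
proof -
  have sym: "symmetric_form h"
    using assms symmetric_form_iff_gram by blast
  have "u = 0" if u: "\<forall>v. h u v = 0" for u
  proof -
    define c where "c = (\<chi> i. coord X i u)"
    have "(gram_matrix h X *v c) $ j = 0" for j
    proof -
      have "0 = h (X j) (\<Sum>i\<in>UNIV. coord X i u *\<^sub>R X i)"
        using u sym basis_expansion[OF X, of u] unfolding symmetric_form_def by metis
      also have "\<dots> = (gram_matrix h X *v c) $ j"
        by (simp add: linear_sum[OF bilinear_linear(1)[OF h]] bilinear_rmul[OF h] c_def
            gram_matrix_def matrix_vector_mult_def mult.commute)
      finally show ?thesis by simp
    qed
    then have "gram_matrix h X *v c = 0"
      by (simp add: vec_eq_iff)
    then have "c = 0"
      using assms(4) by (metis invertible_det_nz invertible_left_inverse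
          matrix_left_invertible_ker)
    then show "u = 0"
      using basis_expansion[OF X, of u] by (simp add: c_def vec_eq_iff)
  qed
  with sym show ?thesis
    by (simp add: pseudo_metric_def)
qed

text \<open>The columns of C are the X-coordinates of an h-orthogonal basis with squares d, the
  witness that \<open>has_signature\<close> asks for.\<close>

lemma has_signature_gram:
  assumes X: "is_basis X" and sym: "symmetric_form h" and C: "det C \<noteq> 0"
    and D: "transpose C ** gram_matrix h X ** C = (\<chi> i j. if i = j then d i else 0)"
  shows "has_signature h (card {i. d i > 0}) (card {i. d i < 0})"
proof -
  let ?E = "\<lambda>j. \<Sum>i\<in>UNIV. C $ i $ j *\<^sub>R X i"
  have "gram_matrix h ?E = (\<chi> i j. if i = j then d i else 0)"
    using sym gram_matrix_change[of h C X] D by (simp add: symmetric_form_def)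
  then have "h (?E i) (?E j) = (if i = j then d i else 0)" for i j
    by (simp add: gram_matrix_def vec_eq_iff)
  then show ?thesis
    using sym is_basis_change[OF X C] unfolding has_signature_def
    by (intro conjI exI[of _ ?E]) auto
qed

lemma pseudo_metric_eqI:
  assumes X: "is_basis X" and g: "pseudo_metric g" and "\<And>k. g y (X k) = g z (X k)"
  shows "y = z"
proof -
  have bil: "bilinear g"
    using g by (simp add: pseudo_metric_def symmetric_form_def)
  have "g y = g z"
    using assms bil by (intro linear_eq_on_basis[OF X]) (auto simp: bilinear_def)
  then have "\<forall>v. g (y - z) v = 0"
    by (simp add: bilinear_lsub[OF bil])
  then have "y - z = 0"
    using g unfolding pseudo_metric_def by blast
  then show ?thesis
    by simp
qed

lemma is_basis_axis: "is_basis (\<lambda>i :: 'n::finite. axis i 1)"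
proof -
  have "basis_matrix (\<lambda>i :: 'n. axis i 1) = mat 1"
    by (simp add: basis_matrix_def mat_def axis_def vec_eq_iff)
  then show ?thesis
    by (simp add: is_basis_iff_invertible invertible_det_nz)
qed

text \<open>The map from z to the functional g(z, -), recorded by its values on the standard basis,
  is injective by nondegeneracy, hence surjective by dimension.\<close>

lemma pseudo_metric_represent:
  fixes \<phi> :: "real ^ 'n \<Rightarrow> real"
  assumes g: "pseudo_metric g" and \<phi>: "linear \<phi>"
  shows "\<exists>!z. \<forall>w. g z w = \<phi> w"
proof -
  have bil: "bilinear g"
    using g by (simp add: pseudo_metric_def symmetric_form_def)
  define T where "T z = (\<chi> i. g z (axis i 1))" for z
  have lin: "linear T"
    by (intro linearI) (simp_all add: T_def vec_eq_iff bilinear_ladd[OF bil] bilinear_lmul[OF bil])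
  have "inj T"
    by (intro injI pseudo_metric_eqI[OF is_basis_axis g]) (simp add: T_def vec_eq_iff)
  then have "surj T"
    by (rule linear_inj_imp_surj[OF lin])
  then obtain z where z: "T z = (\<chi> i. \<phi> (axis i 1))"
    by (metis surjD)
  have "g z = \<phi>"
    using bil z \<phi>
    by (intro linear_eq_on_basis[OF is_basis_axis]) (auto simp: bilinear_def T_def vec_eq_iff)
  then show ?thesis
    by (auto intro!: ex1I[of _ z] pseudo_metric_eqI[OF is_basis_axis g])
qed

section \<open>Curvature of a left invariant metric\<close>

locale metric_algebra =
  fixes br :: "real ^ 'n \<Rightarrow> real ^ 'n \<Rightarrow> real ^ 'n" and g :: "real ^ 'n \<Rightarrow> real ^ 'n \<Rightarrow> real"
  assumes br: "bilinear br" and metric: "pseudo_metric g"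
begin

lemma bilinear_metric: "bilinear g"
  and metric_commute: "g u v = g v u"
  using metric by (auto simp: pseudo_metric_def symmetric_form_def)

lemmas br_simps = bilinear_ladd[OF br] bilinear_radd[OF br] bilinear_lmul[OF br] bilinear_rmul[OF br]
lemmas metric_simps = bilinear_ladd[OF bilinear_metric] bilinear_radd[OF bilinear_metric]
  bilinear_lmul[OF bilinear_metric] bilinear_rmul[OF bilinear_metric]

lemma metric_eqI:
  assumes "\<And>w. g y w = g z w"
  shows "y = z"
  by (rule pseudo_metric_eqI[OF is_basis_axis metric]) (rule assms)

text \<open>Half of the right-hand side is linear in w, so exactly one vector represents it, and the
  definite description denotes that vector.\<close>

lemma koszul:
  "2 * g (levi_civita br g u v) w = g (br u v) w + g (br w u) v + g (br w v) u"
proof -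
  have "linear (\<lambda>w. (g (br u v) w + g (br w u) v + g (br w v) u) / 2)"
    by (intro linearI) (simp_all add: br_simps metric_simps algebra_simps add_divide_distrib)
  from pseudo_metric_represent[OF metric this]
  have "\<exists>!z. \<forall>w. 2 * g z w = g (br u v) w + g (br w u) v + g (br w v) u"
    by (simp add: field_simps)
  from theI'[OF this] show ?thesis
    unfolding levi_civita_def by blast
qed

lemma levi_civita_eqI:
  assumes X: "is_basis X"
    and "\<And>k. 2 * g z (X k) = g (br u v) (X k) + g (br (X k) u) v + g (br (X k) v) u"
  shows "levi_civita br g u v = z"
proof (rule pseudo_metric_eqI[OF X metric])
  show "g (levi_civita br g u v) (X k) = g z (X k)" for k
    using assms(2)[of k] koszul[of u v "X k"] by simp
qed

lemma bilinear_levi_civita: "bilinear (levi_civita br g)"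
proof -
  let ?L = "levi_civita br g"
  have eqI: "y = z" if "\<And>w. 2 * g y w = 2 * g z w" for y z
    using that by (intro metric_eqI) simp
  show ?thesis
    unfolding bilinear_def
  proof (intro conjI allI linearI)
    fix u u' v v' c
    show "?L u (v + v') = ?L u v + ?L u v'"
      by (rule eqI) (simp add: metric_simps distrib_left koszul br_simps)
    show "?L (u + u') v = ?L u v + ?L u' v"
      by (rule eqI) (simp add: metric_simps distrib_left koszul br_simps)
    \<comment> \<open>The rule \<open>koszul\<close> rewrites only terms of the form
      \<open>2 * g (?L u v) w\<close>, so the scalar has to move in front of the 2.\<close>
    have c: "2 * g (c *\<^sub>R ?L u v) w = c * (2 * g (?L u v) w)" for w
      by (simp add: metric_simps)
    show "?L u (c *\<^sub>R v) = c *\<^sub>R ?L u v"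
      by (rule eqI, unfold c koszul) (simp add: metric_simps br_simps algebra_simps)
    show "?L (c *\<^sub>R u) v = c *\<^sub>R ?L u v"
      by (rule eqI, unfold c koszul) (simp add: metric_simps br_simps algebra_simps)
  qed
qed

lemmas levi_civita_simps =
  bilinear_ladd[OF bilinear_levi_civita] bilinear_radd[OF bilinear_levi_civita]
  bilinear_lmul[OF bilinear_levi_civita] bilinear_rmul[OF bilinear_levi_civita]

lemma linear_curvature:
  "linear (\<lambda>u. curvature br g u v w)"
  "linear (\<lambda>v. curvature br g u v w)"
  "linear (\<lambda>w. curvature br g u v w)"
  by (intro linearI; simp add: curvature_def levi_civita_simps br_simps algebra_simps)+

lemma ricci_eq_sum_coord:
  assumes "is_basis X"
  shows "ricci br g u v = (\<Sum>k\<in>UNIV. coord X k (curvature br g u (X k) v))"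
  unfolding ricci_def by (rule trace_matrix_eq_sum_coord[OF assms linear_curvature(2)])

text \<open>In the standard basis the trace is a finite sum of coordinates of curvature vectors,
  each linear in either argument of ric.\<close>

lemma bilinear_ricci: "bilinear (ricci br g)"
  unfolding bilinear_def ricci_eq_sum_coord[OF is_basis_axis, abs_def]
  by (intro conjI allI linear_compose_sum ballI;
      rule linear_compose[OF _ linear_coord, unfolded o_def], rule linear_curvature)

lemma metric_ricci_operator: "g (ricci_operator br g u) v = ricci br g u v"
  using theI'[OF pseudo_metric_represent[OF metric bilinear_linear(1)[OF bilinear_ricci]]]
  unfolding ricci_operator_def by blast

lemma ricci_operator_eqI:
  assumes "is_basis X" "\<And>k. g z (X k) = ricci br g u (X k)"
  shows "ricci_operator br g u = z"
  using assms(2) by (intro pseudo_metric_eqI[OF assms(1) metric]) (simp add: metric_ricci_operator)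

lemma linear_ricci_operator: "linear (ricci_operator br g)"
  by (intro linearI metric_eqI)
    (simp_all add: metric_simps metric_ricci_operator bilinear_ladd[OF bilinear_ricci]
      bilinear_lmul[OF bilinear_ricci])

lemma ricci_operator_self_adjoint:
  assumes "symmetric_form (ricci br g)"
  shows "g (ricci_operator br g u) v = g u (ricci_operator br g v)"
  using assms by (metis metric_commute metric_ricci_operator symmetric_form_def)

end

section \<open>Ricci curvature of the given metric on Sol\<close>

theorem proposition4p14:
  fixes br :: "real ^ 3 \<Rightarrow> real ^ 3 \<Rightarrow> real ^ 3"
    and X :: "3 \<Rightarrow> real ^ 3"
    and g :: "real ^ 3 \<Rightarrow> real ^ 3 \<Rightarrow> real"
    and b :: real
  assumes "lie_bracket br"
    and "is_basis X"
    and "br (X 1) (X 2) = X 2"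
    and "br (X 1) (X 3) = - X 3"
    and "br (X 2) (X 3) = 0"
    and "b > 0"
    and "bilinear g"
    and "gram_matrix g X =
           vector [vector [0, 0, - 2 / b],
                   vector [0, 1, 1],
                   vector [- 2 / b, 1, 1]]"
  shows "pseudo_metric g
    \<and> gram_matrix (ricci br g) X =
        vector [vector [- 2, b, 0],
                vector [b, - (1 / 2) * b ^ 2, - (1 / 2) * b ^ 2],
                vector [0, - (1 / 2) * b ^ 2, - (1 / 2) * b ^ 2]]
    \<and> scalar_curvature br g = 1 / 2 * b ^ 2
    \<and> type_ab2 g (ricci_operator br g)
    \<and> det (gram_matrix (ricci br g) X) = b ^ 4 / 2
    \<and> trace (gram_matrix (ricci br g) X) = - 2 - b ^ 2
    \<and> has_signature (ricci br g) 1 2"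
proof -
  note X = \<open>is_basis X\<close> and b = \<open>b > 0\<close> and bil = \<open>bilinear g\<close>
  note gram = assms(8)
  \<comment> \<open>The columns of \<open>C\<close> and \<open>C'\<close> are orthogonal bases for the metric and the Ricci form, with
    squares \<open>d\<close> and \<open>d'\<close>; those of \<open>Q\<close> are a Jordan basis of the Ricci operator, whose matrix
    is \<open>R\<close>. All are in coordinates with respect to \<open>X\<close>.\<close>
  define C :: "real ^ 3 ^ 3" where
    "C = vector [vector [0, 1, 1], vector [1, - 1, 1], vector [0, 1, - 1]]"
  define C' :: "real ^ 3 ^ 3" where
    "C' = vector [vector [1, 0, b / 2], vector [0, 0, 1], vector [0, 1, - 1]]"
  define Q :: "real ^ 3 ^ 3" where
    "Q = vector [vector [0, 0, 1], vector [1, - b / 2, 1 / (2 * b)], vector [1, b / 2, 1 / (2 * b)]]"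
  define R :: "real ^ 3 ^ 3" where
    "R = vector [vector [b\<^sup>2 / 2, 0, 0], vector [0, 0, - (b\<^sup>2 / 2)], vector [b, - (b\<^sup>2 / 2), 0]]"
  define d :: "3 \<Rightarrow> real" where "d = ($) (vector [1, - (4 / b), 4 / b])"
  define d' :: "3 \<Rightarrow> real" where "d' = ($) (vector [- 2, - (b\<^sup>2 / 2), b\<^sup>2 / 2])"
  note mat_simps = vec_eq_iff forall_3 transpose_def matrix_matrix_mult_def sum_3 det_3

  have sol_bilinear: "bilinear br" and br_self: "br u u = 0" for u
    using \<open>lie_bracket br\<close> by (auto simp: lie_bracket_def)
  have br_swap: "br u v = - br v u" for u v
    using br_self[of "u + v"] br_self[of u] br_self[of v]
    by (simp add: bilinear_ladd[OF sol_bilinear] bilinear_radd[OF sol_bilinear] eq_neg_iff_add_eq_0 add.commute)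
  have brX: "br (X 1) (X 1) = 0" "br (X 2) (X 2) = 0" "br (X 3) (X 3) = 0"
    "br (X 1) (X 2) = X 2" "br (X 1) (X 3) = - X 3" "br (X 2) (X 3) = 0"
    "br (X 2) (X 1) = - X 2" "br (X 3) (X 1) = X 3" "br (X 3) (X 2) = 0"
    using assms br_self br_swap[of "X 2" "X 1"] br_swap[of "X 3" "X 1"] br_swap[of "X 3" "X 2"]
    by auto
  have gX: "g (X 1) (X 1) = 0" "g (X 1) (X 2) = 0" "g (X 1) (X 3) = - 2 / b"
    "g (X 2) (X 1) = 0" "g (X 2) (X 2) = 1" "g (X 2) (X 3) = 1"
    "g (X 3) (X 1) = - 2 / b" "g (X 3) (X 2) = 1" "g (X 3) (X 3) = 1"
    using gram by (simp_all add: gram_matrix_def vec_eq_iff forall_3)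

  have metric: "pseudo_metric g"
    by (rule pseudo_metric_gram[OF X bil]) (use b in \<open>simp_all add: gram mat_simps\<close>)
  interpret metric_algebra br g
    using sol_bilinear metric by unfold_locales
  \<comment> \<open>The vectors X1 and n = X3 - X2 are null, orthogonal to the unit vector X2, and
    pair to -2/b. Hence X2, X1 + n, X1 - n are orthogonal with squares 1, -4/b, 4/b.\<close>
  have sig_g: "has_signature g 2 1"
  proof -
    have "{i. d i > 0} = {1, 3}" "{i. d i < 0} = {2}"
      using b exhaust_3 by (force simp: d_def)+
    moreover have "has_signature g (card {i. d i > 0}) (card {i. d i < 0})"
      using metric b unfolding pseudo_metric_def
      by (intro has_signature_gram[OF X, where C = C])
        (simp_all add: gram C_def d_def mat_simps)
    ultimately show ?thesis by (simp add: numeral_2_eq_2)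
  qed

  note g_simps = gX metric_simps bilinear_lneg[OF bil] bilinear_rneg[OF bil] bilinear_lsub[OF bil]
    bilinear_lzero[OF bil] bilinear_rzero[OF bil]
  let ?L = "levi_civita br g"
  \<comment> \<open>The universally quantified premise lets \<open>forall_3\<close> split the check
    into the three basis vectors.\<close>
  have LI: "?L u v = z"
    if "\<forall>k. 2 * g z (X k) = g (br u v) (X k) + g (br (X k) u) v + g (br (X k) v) u" for u v z
    by (rule levi_civita_eqI[OF X]) (rule that[rule_format])
  \<comment> \<open>Each value is the unique solution of three linear equations, the Koszul identity
    paired with X1, X2 and X3.\<close>
  have LX: "?L (X 1) (X 1) = X 1" "?L (X 1) (X 2) = (- b / 2) *\<^sub>R X 1"
    "?L (X 1) (X 3) = (- b / 2) *\<^sub>R X 1 - X 3"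
    "?L (X 2) (X 1) = (- b / 2) *\<^sub>R X 1 - X 2" "?L (X 2) (X 2) = (b / 2) *\<^sub>R X 2 - (b / 2) *\<^sub>R X 3"
    "?L (X 2) (X 3) = 0" "?L (X 3) (X 1) = (- b / 2) *\<^sub>R X 1" "?L (X 3) (X 2) = 0"
    "?L (X 3) (X 3) = (b / 2) *\<^sub>R X 3 - (b / 2) *\<^sub>R X 2"
    by (rule LI, use b in \<open>simp add: forall_3 brX g_simps\<close>)+

  note lc = bilinear_levi_civita
  have ricX: "ricci br g (X i) (X j) = (\<Sum>k\<in>UNIV. coord X k (curvature br g (X i) (X k) (X j)))" for i j
    by (rule ricci_eq_sum_coord[OF X])
  have gram_ric: "gram_matrix (ricci br g) X =
        vector [vector [- 2, b, 0],
                vector [b, - (1 / 2) * b ^ 2, - (1 / 2) * b ^ 2],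
                vector [0, - (1 / 2) * b ^ 2, - (1 / 2) * b ^ 2]]"
    by (simp add: gram_matrix_def vec_eq_iff forall_3 ricX sum_3 curvature_def brX LX
        levi_civita_simps bilinear_lneg[OF lc] bilinear_rneg[OF lc] bilinear_lsub[OF lc]
        bilinear_rsub[OF lc] bilinear_lzero[OF lc] bilinear_rzero[OF lc]
        linear_add[OF linear_coord] linear_diff[OF linear_coord] linear_neg[OF linear_coord]
        linear_0[OF linear_coord] linear_scale[OF linear_coord] coord_basis[OF X]
        power2_eq_square)
  have ric_sym: "symmetric_form (ricci br g)"
    by (subst symmetric_form_iff_gram[OF X bilinear_ricci]) (simp add: gram_ric mat_simps)
  \<comment> \<open>Gram-Schmidt for ric on X1, X3, X2: the first two are already orthogonal, and X2
    is corrected to X2 + (b/2) X1 - X3.\<close>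
  have sig_ric: "has_signature (ricci br g) 1 2"
  proof -
    have "{i. d' i > 0} = {3}" "{i. d' i < 0} = {1, 2}"
      using b exhaust_3 by (force simp: d'_def)+
    moreover have "has_signature (ricci br g) (card {i. d' i > 0}) (card {i. d' i < 0})"
      using b
      by (intro has_signature_gram[OF X ric_sym, where C = C'])
        (simp_all add: gram_ric C'_def d'_def mat_simps power2_eq_square)
    ultimately show ?thesis by (simp add: numeral_2_eq_2)
  qed

  have ric_vals: "ricci br g (X i) (X j) = gram_matrix (ricci br g) X $ i $ j" for i j
    by (simp add: gram_matrix_def)
  let ?Ric = "ricci_operator br g"
  have RicI: "?Ric u = z" if "\<forall>k. g z (X k) = ricci br g u (X k)" for u z
    by (rule ricci_operator_eqI[OF X]) (rule that[rule_format])
  have RicX: "?Ric (X 1) = (b\<^sup>2 / 2) *\<^sub>R X 1 + b *\<^sub>R X 3" "?Ric (X 2) = - ((b\<^sup>2 / 2) *\<^sub>R X 3)"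
    "?Ric (X 3) = - ((b\<^sup>2 / 2) *\<^sub>R X 2)"
    by (rule RicI, use b in \<open>simp add: forall_3 ric_vals gram_ric g_simps power2_eq_square\<close>)+
  have "scalar_curvature br g = 1 / 2 * b ^ 2"
    by (simp add: scalar_curvature_def trace_matrix_eq_sum_coord[OF X linear_ricci_operator] sum_3
        RicX linear_add[OF linear_coord] linear_neg[OF linear_coord] linear_scale[OF linear_coord]
        coord_basis[OF X])
  moreover have "type_ab2 g ?Ric"
  proof -
    have R: "?Ric (X j) = (\<Sum>i\<in>UNIV. R $ i $ j *\<^sub>R X i)" for j
      using exhaust_3[of j] by (auto simp: RicX R_def sum_3)
    \<comment> \<open>The Jordan basis in Q: X2 + X3 has eigenvalue -b^2/2 and (b/2)(X3 - X2) has
      eigenvalue b^2/2. Applying Ric - b^2/2 to X1 gives b X3 = (b/2)(X3 - X2) + (b/2)(X2 + X3);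
      adding (1/(2b))(X2 + X3) to X1 cancels the second term, which yields the generalised
      eigenvector.\<close>
    have "\<exists>P :: real ^ 3 ^ 3. invertible P \<and> matrix_inv P ** matrix ?Ric ** P =
        vector [vector [- (b\<^sup>2 / 2), 0, 0], vector [0, b\<^sup>2 / 2, 1], vector [0, 0, b\<^sup>2 / 2]]"
      by (rule matrix_conjugate[OF X linear_ricci_operator R, where C = Q])
        (use b in \<open>simp_all add: Q_def R_def mat_simps field_simps power2_eq_square\<close>)
    then show ?thesis
      unfolding type_ab2_def
      using sig_g linear_ricci_operator ricci_operator_self_adjoint[OF ric_sym] by blast
  qed
  moreover have "det (gram_matrix (ricci br g) X) = b ^ 4 / 2"
    by (simp add: gram_ric det_3 power2_eq_square power4_eq_xxxx)
  moreover have "trace (gram_matrix (ricci br g) X) = - 2 - b ^ 2"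
    by (simp add: gram_ric trace_def sum_3)
  ultimately show ?thesis
    using metric gram_ric sig_ric by (intro conjI)
qed

end
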